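(* Let $k>0$, and let $\Gamma^{(1)}$ and $\Gamma^{(2)}$ be two periodic curves with periods $L_1>0$ and $L_2>0$, respectively, such that either both satisfy Condition (i) or both satisfy Condition (ii). Let $\theta\in(-\pi/2,\pi/2)$ satisfy $kL_j\sin\theta/\pi\notin\mathbb{Z}$ for $j=1,2$, and let $u_j(x;\theta)$ be the total field of the diffraction problem for $\Gamma^{(j)}$ (with period $L_j$) and incident angle $\theta$, $j=1,2$. Suppose that for some $h>\max\{x_2:x\in\Gamma^{(1)}\cup\Gamma^{(2)}\}$ $$|u_1(x;\theta)|=|u_2(x;\theta)|\quad\text{for all }x\in U_h:=\{x\in\mathbb{R}^2:x_2>h\}.$$ Then $u_1(x;\theta)=u_2(x;\theta)$ for all $x\in U_h$.
   Context: A periodic curve $\Gamma\subset\mathbb{R}^2$ with period $L>0$ is a curve that is $L$-periodic in the $x_1$-direction and bounded in the $x_2$-direction; $\Omega$ denotes the unbounded connected domain above $\Gamma$. Condition (i): $\Gamma$ is the graph (over the $x_1$-axis) of a 3-times continuously differentiable function. Condition (ii): $\Gamma$ is an analytic curve. Diffraction problem for $\Gamma$ (with period $L$), wave number $k>0$ and incident angle $\theta\in(-\pi/2,\pi/2)$: the incident field is $u^i(x)=e^{ikx_1\sin\theta-ikx_2\cos\theta}$. With $\alpha=k\sin\theta$, find a total field $u=u^i+u^s\in C^2(\Omega)\cap C(\overline{\Omega})$ such that (1) $\Delta u+k^2u=0$ in $\Omega$ and $u=0$ on $\Gamma$; (2) $u$ is $\alpha$-quasi-periodic, i.e. $e^{-i\alpha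 x_1}u(x)$ is $L$-periodic with respect to $x_1$; (3) the scattered field $u^s$ satisfies the Rayleigh expansion: there are coefficients $A_n\in\mathbb{C}$, $n\in\mathbb{Z}$, with $u^s(x)=\sum_{n\in\mathbb{Z}}A_ne^{i\alpha_nx_1+i\beta_nx_2}$ for $x_2>h$, for any $h>\max\{x_2:x\in\Gamma\}$, where $\alpha_n=\alpha+2n\pi/L$, and $\beta_n=\sqrt{k^2-\alpha_n^2}$ if $|\alpha_n|\le k$, $\beta_n=i\sqrt{\alpha_n^2-k^2}$ if $|\alpha_n|>k$. Under Condition (i) this problem has a unique solution; under Condition (ii) it has at least one solution, and if there are several, the total field denotes any one of them. *)

theory Defs
  imports "HOL-Analysis.Analysis"
begin

definition partial :: "'a::euclidean_space \<Rightarrow> ('a \<Rightarrow> 'b::real_normed_vector) \<Rightarrow> 'a \<Rightarrow> 'b" where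
  "partial b f x = frechet_derivative f (at x) b"

text \<open>Only used on open sets \<open>S\<close>, where it is the usual notion of \<open>f\<close> being \<open>k\<close> times
  continuously differentiable.\<close>

fun Ck_on :: "nat \<Rightarrow> ('a::euclidean_space \<Rightarrow> 'b::real_normed_vector) \<Rightarrow> 'a set \<Rightarrow> bool" where
  "Ck_on 0 f S \<longleftrightarrow> continuous_on S f"
| "Ck_on (Suc k) f S \<longleftrightarrow> (\<forall>x\<in>S. f differentiable (at x)) \<and> (\<forall>b\<in>Basis. Ck_on k (partial b f) S)"

definition laplacian :: "('a::euclidean_space \<Rightarrow> 'b::real_normed_vector) \<Rightarrow> 'a \<Rightarrow> 'b" where
  "laplacian u x = (\<Sum>b\<in>Basis. partial b (partial b u) x)"

definition real_analytic :: "(real \<Rightarrow> 'b::real_normed_vector) \<Rightarrow> bool" where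
  "real_analytic g \<longleftrightarrow>
     (\<forall>t0. \<exists>r>0. \<exists>c. \<forall>t. \<bar>t - t0\<bar> < r \<longrightarrow> (\<lambda>n. (t - t0) ^ n *\<^sub>R c n) sums g t)"

text \<open>A periodic curve is a properly embedded (hence non-self-intersecting) line, so that it
  separates the plane. \<open>L\<close> need not be the minimal period.\<close>

definition periodic_curve :: "real \<Rightarrow> (real^2) set \<Rightarrow> bool" where
  "periodic_curve L \<Gamma> \<longleftrightarrow>
     closed \<Gamma> \<and> \<Gamma> homeomorphic (UNIV :: real set) \<and>
     (\<forall>x. x + axis 1 L \<in> \<Gamma> \<longleftrightarrow> x \<in> \<Gamma>) \<and>
     bounded ((\<lambda>x. x $ 2) ` \<Gamma>)"

definition C3_graph :: "(real^2) set \<Rightarrow> bool" where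
  "C3_graph \<Gamma> \<longleftrightarrow> (\<exists>f :: real \<Rightarrow> real. Ck_on 3 f UNIV \<and> \<Gamma> = {x. x $ 2 = f (x $ 1)})"

text \<open>Analytic curves are regular: without the condition on the derivative, corners and cusps
  would be admitted.\<close>

definition analytic_curve :: "(real^2) set \<Rightarrow> bool" where
  "analytic_curve \<Gamma> \<longleftrightarrow>
     (\<exists>\<gamma> :: real \<Rightarrow> real^2. real_analytic \<gamma> \<and> inj \<gamma> \<and>
        (\<forall>t. vector_derivative \<gamma> (at t) \<noteq> 0) \<and> range \<gamma> = \<Gamma>)"

definition upper_half_plane :: "real \<Rightarrow> (real^2) set" where
  "upper_half_plane h = {x. x $ 2 > h}"

text \<open>The maximum of \<open>x\<^sub>2\<close> over a periodic curve; it is attained because the curve is closed,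
  periodic and bounded in the \<open>x\<^sub>2\<close>-direction.\<close>

definition max_height :: "(real^2) set \<Rightarrow> real" where
  "max_height \<Gamma> = (SUP x\<in>\<Gamma>. x $ 2)"

text \<open>The union is over exactly one component when \<open>\<Gamma>\<close> is bounded above: see the lemma below.\<close>

definition domain_above :: "(real^2) set \<Rightarrow> (real^2) set" where
  "domain_above \<Gamma> = \<Union> {C \<in> components (- \<Gamma>). \<exists>h. upper_half_plane h \<subseteq> C}"

lemma domain_above_unique_component:
  assumes C: "C \<in> components (- \<Gamma>)" and h: "upper_half_plane h \<subseteq> C"
  shows "domain_above \<Gamma> = C"
proof -
  have "D = C" if D: "D \<in> components (- \<Gamma>)" and h': "upper_half_plane h' \<subseteq> D" for D h'
  proof -
    have "axis 2 (max h h' + 1) \<in> upper_half_plane h \<inter> upper_half_plane h'"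
      by (auto simp: upper_half_plane_def axis_def)
    then have "C \<inter> D \<noteq> {}" using h h' by blast
    then show ?thesis using C D components_eq by blast
  qed
  then show ?thesis using assms unfolding domain_above_def by blast
qed

definition incident_field :: "real \<Rightarrow> real \<Rightarrow> real^2 \<Rightarrow> complex" where
  "incident_field k \<theta> x =
     exp (\<i> * of_real (k * x $ 1 * sin \<theta>) - \<i> * of_real (k * x $ 2 * cos \<theta>))"

definition alpha_n :: "real \<Rightarrow> real \<Rightarrow> real \<Rightarrow> int \<Rightarrow> real" where
  "alpha_n L k \<theta> n = k * sin \<theta> + 2 * of_int n * pi / L"

definition beta_n :: "real \<Rightarrow> real \<Rightarrow> real \<Rightarrow> int \<Rightarrow> complex" where
  "beta_n L k \<theta> n =
     (if \<bar>alpha_n L k \<theta> n\<bar> \<le> k then of_real (sqrt (k\<^sup>2 - (alpha_n L k \<theta> n)\<^sup>2))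
      else \<i> * of_real (sqrt ((alpha_n L k \<theta> n)\<^sup>2 - k\<^sup>2)))"

definition quasi_periodic_on :: "real \<Rightarrow> real \<Rightarrow> (real^2) set \<Rightarrow> (real^2 \<Rightarrow> complex) \<Rightarrow> bool" where
  "quasi_periodic_on L \<alpha> S u \<longleftrightarrow>
     (\<forall>x\<in>S. exp (- \<i> * of_real (\<alpha> * (x + axis 1 L) $ 1)) * u (x + axis 1 L)
           = exp (- \<i> * of_real (\<alpha> * x $ 1)) * u x)"

definition rayleigh_expansion ::
  "real \<Rightarrow> real \<Rightarrow> real \<Rightarrow> (real^2) set \<Rightarrow> (real^2 \<Rightarrow> complex) \<Rightarrow> bool" where
  "rayleigh_expansion L k \<theta> \<Gamma> us \<longleftrightarrow>
     (\<exists>A :: int \<Rightarrow> complex. \<forall>h > max_height \<Gamma>. \<forall>x\<in>upper_half_plane h.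
        ((\<lambda>n. A n * exp (\<i> * of_real (alpha_n L k \<theta> n) * of_real (x $ 1)
                          + \<i> * beta_n L k \<theta> n * of_real (x $ 2)))
           has_sum us x) UNIV)"

text \<open>\<open>u\<close> is a total field; its values off the closure of \<open>domain_above \<Gamma>\<close> are irrelevant.\<close>

definition diffraction_solution ::
  "real \<Rightarrow> real \<Rightarrow> real \<Rightarrow> (real^2) set \<Rightarrow> (real^2 \<Rightarrow> complex) \<Rightarrow> bool" where
  "diffraction_solution L k \<theta> \<Gamma> u \<longleftrightarrow>
     Ck_on 2 u (domain_above \<Gamma>) \<and> continuous_on (closure (domain_above \<Gamma>)) u \<and>
     (\<forall>x\<in>domain_above \<Gamma>. laplacian u x + (of_real k)\<^sup>2 * u x = 0) \<and>
     (\<forall>x\<in>\<Gamma>. u x = 0) \<and>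
     quasi_periodic_on L (k * sin \<theta>) (closure (domain_above \<Gamma>)) u \<and>
     rayleigh_expansion L k \<theta> \<Gamma> (\<lambda>x. u x - incident_field k \<theta> x)"

end

theory Submission
  imports Defs
begin

text \<open>Write \<open>\<alpha> = k sin \<theta>\<close> and \<open>\<beta> = k cos \<theta>\<close>. Above both curves each total field is an absolutely
  convergent sum of plane waves \<open>exp (i (\<xi> x\<^sub>1 + \<eta> x\<^sub>2))\<close>, the incident wave with wave vector
  \<open>(\<alpha>, -\<beta>)\<close> being one of them. Hence \<open>|u|\<^sup>2\<close> is a sum of interference terms, one for each pair
  \<open>(p, q)\<close> of wave vectors present, with coefficient \<open>a p * cnj (a q)\<close> and with frequency
  \<open>p - cnj q\<close>, the complex conjugate being taken in the second component. Two facts turn the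
  equality of the moduli into the equality of the fields.

  First, such a sum determines its coefficients (\<open>isolated_coefficient_eq_0\<close>): if it vanishes in
  a half plane and a frequency occurs for one index only, then the coefficient of that index is
  zero. Only finitely many terms decay no faster than a given exponential rate, and each of them
  can be removed by subtracting a multiple of the sum from a translate of it. What remains is one
  term together with terms that decay strictly faster.

  Secondly, the interference of a scattered mode \<open>p\<close> with the incident wave has a frequency that
  no other pair of waves produces (\<open>incident_beat_unique\<close>). For propagating modes the wave
  vectors lie on a circle, on which a nonzero chord vector \<open>p - q\<close> determines \<open>p\<close> and \<open>q\<close> up to
  replacing them by \<open>-q\<close> and \<open>-p\<close>. With \<open>q = (\<alpha>, -\<beta>)\<close> the second choice would require a
  scattered mode with horizontal wave number \<open>-\<alpha>\<close>, and this is what \<open>k L sin \<theta> / \<pi> \<notin> \<int>\<close>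
  forbids. An evanescent mode \<open>p\<close> is handled by comparing oscillation and decay in the \<open>x\<^sub>2\<close>
  direction separately.

  As the incident amplitude is 1, the coefficient of that interference term is the amplitude of
  the scattered mode itself. So both gratings have the same scattered amplitudes. This includes
  the case of incommensurable periods: a mode that occurs for one grating only must have
  amplitude zero.\<close>

section \<open>Plane waves\<close>

definition plane_wave :: "real \<times> complex \<Rightarrow> real^2 \<Rightarrow> complex" where
  "plane_wave w x =
     exp (\<i> * of_real (fst w) * of_real (x $ 1) + \<i> * snd w * of_real (x $ 2))"

lemma plane_wave_add: "plane_wave w (x + y) = plane_wave w x * plane_wave w y"
  by (simp add: plane_wave_def algebra_simps flip: exp_add)

lemma plane_wave_nonzero: "plane_wave w x \<noteq> 0"
  by (simp add: plane_wave_def)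

lemma cmod_plane_wave: "cmod (plane_wave w x) = exp (- Im (snd w) * x $ 2)"
  by (simp add: plane_wave_def)

text \<open>The direction \<open>y\<close> points upwards, so that translation by \<open>y\<close> preserves the half planes in
  which the expansions converge.\<close>

lemma plane_waves_separated:
  assumes "w \<noteq> w'"
  shows "\<exists>y. y $ 2 \<ge> 0 \<and> plane_wave w y \<noteq> plane_wave w' y"
proof -
  \<comment> \<open>A period of the exponential function cannot have modulus 1.\<close>
  have period: "exp (\<i> * z * of_real (1 / cmod z)) \<noteq> 1" if "z \<noteq> 0" for z :: complex
  proof
    define v where "v = \<i> * z * of_real (1 / cmod z)"
    assume "exp (\<i> * z * of_real (1 / cmod z)) = 1"
    then obtain n :: int where n: "Re v = 0" "Im v = of_int (2 * n) * pi"
      unfolding v_def[symmetric] exp_eq_1 by blast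
    have "cmod v = 1"
      using that by (simp add: v_def norm_mult norm_divide)
    then have "\<bar>2 * of_int n * pi\<bar> = 1"
      using n by (simp add: cmod_def abs_mult)
    moreover have "\<bar>of_int n * pi\<bar> \<ge> 3" if "n \<noteq> 0"
    proof -
      have "1 \<le> \<bar>of_int n :: real\<bar>" using that by linarith
      then have "1 * 3 \<le> \<bar>of_int n\<bar> * pi"
        using pi_gt3 by (intro mult_mono) auto
      then show ?thesis by (simp add: abs_mult)
    qed
    ultimately show False
      by (cases "n = 0") (auto simp: abs_mult)
  qed
  show ?thesis
  proof (cases "fst w = fst w'")
    case False
    define z :: complex where "z = of_real (fst w - fst w')"
    define y :: "real^2" where "y = axis 1 (1 / cmod z)"
    have "plane_wave w y = plane_wave w' y * exp (\<i> * z * of_real (1 / cmod z))"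
      by (simp add: plane_wave_def y_def z_def axis_def algebra_simps diff_divide_distrib
          flip: exp_add)
    then have "plane_wave w y \<noteq> plane_wave w' y"
      using period[of z] False plane_wave_nonzero[of w' y] by (auto simp: z_def)
    moreover have "y $ 2 \<ge> 0" by (simp add: y_def axis_def)
    ultimately show ?thesis by blast
  next
    case True
    define z where "z = snd w - snd w'"
    define y :: "real^2" where "y = axis 2 (1 / cmod z)"
    have "z \<noteq> 0" using assms True by (auto simp: z_def prod_eq_iff)
    have "plane_wave w y = plane_wave w' y * exp (\<i> * z * of_real (1 / cmod z))"
      by (simp add: plane_wave_def y_def z_def axis_def algebra_simps diff_divide_distrib
          flip: exp_add)
    then have "plane_wave w y \<noteq> plane_wave w' y"
      using period[OF \<open>z \<noteq> 0\<close>] plane_wave_nonzero[of w' y] by auto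
    moreover have "y $ 2 \<ge> 0" by (simp add: y_def axis_def)
    ultimately show ?thesis by blast
  qed
qed

section \<open>Uniqueness of the coefficients\<close>

text \<open>Subtracting \<open>plane_wave w' y\<close> times the sum from its translate by \<open>y\<close> multiplies the
  coefficient of each frequency \<open>w\<close> by \<open>plane_wave w y - plane_wave w' y\<close>. This removes the
  frequency \<open>w'\<close> and, for a suitable \<open>y\<close>, keeps a given other frequency.\<close>

lemma remove_finitely_many_terms:
  fixes w :: "'i \<Rightarrow> real \<times> complex"
  assumes "finite K" and "\<forall>j\<in>K. w j \<noteq> w j0"
    and "\<forall>x\<in>upper_half_plane h. ((\<lambda>j. c j * plane_wave (w j) x) has_sum 0) J"
  shows "\<exists>d. (\<forall>x\<in>upper_half_plane h. ((\<lambda>j. d j * plane_wave (w j) x) has_sum 0) J) \<and>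
           (\<forall>j\<in>K. d j = 0) \<and> (d j0 = 0 \<longrightarrow> c j0 = 0)"
  using assms(1,2)
proof (induction K rule: finite_induct)
  case empty
  then show ?case using assms(3) by (intro exI[of _ c]) auto
next
  case (insert j1 K)
  then obtain d where
    d: "\<And>x. x \<in> upper_half_plane h \<Longrightarrow> ((\<lambda>j. d j * plane_wave (w j) x) has_sum 0) J"
      "\<forall>j\<in>K. d j = 0" "d j0 = 0 \<longrightarrow> c j0 = 0"
    by auto
  obtain y where y: "y $ 2 \<ge> 0" "plane_wave (w j0) y \<noteq> plane_wave (w j1) y"
    using plane_waves_separated[of "w j0" "w j1"] insert.prems by fastforce
  define d' where "d' j = d j * (plane_wave (w j) y - plane_wave (w j1) y)" for j
  have "((\<lambda>j. d' j * plane_wave (w j) x) has_sum 0) J" if x: "x \<in> upper_half_plane h" for x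
  proof -
    have "x + y \<in> upper_half_plane h"
      using x y(1) by (simp add: upper_half_plane_def)
    from has_sum_add[OF d(1)[OF this] has_sum_cmult_right[OF d(1)[OF x], of "- plane_wave (w j1) y"]]
    show ?thesis
      by (simp add: d'_def plane_wave_add algebra_simps)
  qed
  moreover have "\<forall>j\<in>insert j1 K. d' j = 0" and "d' j0 = 0 \<longrightarrow> c j0 = 0"
    using d y(2) by (auto simp: d'_def)
  ultimately show ?case by blast
qed

text \<open>After the removal of all other terms with \<open>Im (snd (w j)) \<le> Im (snd (w j0)) + 1\<close>, the sum
  says that the term of \<open>j0\<close> is cancelled by terms that are smaller by a factor \<open>exp (- r)\<close> at
  height \<open>r\<close> above a base point.\<close>

lemma isolated_coefficient_eq_0:
  fixes w :: "'i \<Rightarrow> real \<times> complex"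
  assumes finite_rate: "\<And>B. finite {j \<in> J. Im (snd (w j)) \<le> B}"
    and zero: "\<forall>x\<in>upper_half_plane h. ((\<lambda>j. c j * plane_wave (w j) x) has_sum 0) J"
    and "j0 \<in> J" and isolated: "\<forall>j\<in>J - {j0}. w j \<noteq> w j0"
  shows "c j0 = 0"
proof -
  define b where "b = Im (snd (w j0))"
  define K where "K = {j \<in> J. Im (snd (w j)) \<le> b + 1} - {j0}"
  have "finite K" "\<forall>j\<in>K. w j \<noteq> w j0"
    using finite_rate isolated by (auto simp: K_def)
  from remove_finitely_many_terms[OF this zero] obtain d where
    d: "\<And>x. x \<in> upper_half_plane h \<Longrightarrow> ((\<lambda>j. d j * plane_wave (w j) x) has_sum 0) J"
      "\<forall>j\<in>K. d j = 0" "d j0 = 0 \<longrightarrow> c j0 = 0"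
    by auto
  define x :: "real^2" where "x = axis 2 (h + 1)"
  have x: "x \<in> upper_half_plane h"
    by (simp add: x_def upper_half_plane_def axis_def)
  define C where "C = (\<Sum>\<^sub>\<infinity>j\<in>J. cmod (d j * plane_wave (w j) x))"
  have C: "((\<lambda>j. cmod (d j * plane_wave (w j) x)) has_sum C) J"
    unfolding C_def using has_sum_imp_summable[OF d(1)[OF x]]
    by (intro has_sum_infsum) (simp add: summable_on_iff_abs_summable_on_complex)
  have bound: "cmod (d j0 * plane_wave (w j0) x) \<le> C * exp (- r)" if r: "r \<ge> 0" for r
  proof -
    define y :: "real^2" where "y = x + axis 2 r"
    have y: "y \<in> upper_half_plane h"
      using r by (simp add: x_def y_def upper_half_plane_def axis_def)
    have shift: "cmod (d j * plane_wave (w j) y)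
        = cmod (d j * plane_wave (w j) x) * exp (- Im (snd (w j)) * r)" for j
      by (simp add: y_def plane_wave_add norm_mult cmod_plane_wave axis_def)
    have "((\<lambda>j. d j * plane_wave (w j) y) has_sum (0 - d j0 * plane_wave (w j0) y)) (J - {j0})"
      using d(1)[OF y] \<open>j0 \<in> J\<close> by (intro has_sum_Diff) (auto intro: has_sum_finiteI)
    moreover have "((\<lambda>j. cmod (d j * plane_wave (w j) x) * exp (- (b + 1) * r))
        has_sum (C * exp (- (b + 1) * r) - cmod (d j0 * plane_wave (w j0) x) * exp (- (b + 1) * r)))
          (J - {j0})"
      using has_sum_cmult_left[OF C] \<open>j0 \<in> J\<close>
      by (intro has_sum_Diff) (auto intro: has_sum_finiteI)
    ultimately have "cmod (0 - d j0 * plane_wave (w j0) y)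
        \<le> C * exp (- (b + 1) * r) - cmod (d j0 * plane_wave (w j0) x) * exp (- (b + 1) * r)"
    proof (rule norm_infsum_le)
      fix j assume j: "j \<in> J - {j0}"
      show "cmod (d j * plane_wave (w j) y)
        \<le> cmod (d j * plane_wave (w j) x) * exp (- (b + 1) * r)"
      proof (cases "j \<in> K")
        case True
        then show ?thesis using d(2) by simp
      next
        case False
        then have "- Im (snd (w j)) * r \<le> - (b + 1) * r"
          using j r by (intro mult_right_mono) (auto simp: K_def)
        then show ?thesis using j by (auto simp: shift intro!: mult_left_mono)
      qed
    qed
    also have "\<dots> \<le> C * exp (- (b + 1) * r)" by simp
    finally have "cmod (d j0 * plane_wave (w j0) x) * exp (- b * r) \<le> C * exp (- (b + 1) * r)"
      unfolding b_def by (simp only: diff_0 norm_minus_cancel shift)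
    also have "\<dots> = C * exp (- r) * exp (- b * r)"
      by (simp add: algebra_simps flip: exp_add)
    finally show ?thesis by simp
  qed
  have "((\<lambda>r. C * exp (- r)) \<longlongrightarrow> C * 0) at_top"
    by (intro tendsto_intros filterlim_compose[OF exp_at_bot] filterlim_uminus_at_bot_at_top)
  then have "cmod (d j0 * plane_wave (w j0) x) \<le> C * 0"
    by (rule tendsto_lowerbound) (auto intro!: bound eventually_at_top_linorderI)
  then show ?thesis
    using d(3) plane_wave_nonzero by simp
qed

section \<open>Interference with the incident wave\<close>

text \<open>This is \<open>beta_n\<close> as a function of \<open>alpha_n\<close>: in this form it is common to all periods.\<close>

definition vertical_wavenumber :: "real \<Rightarrow> real \<Rightarrow> complex" where
  "vertical_wavenumber k \<xi> =
     (if \<bar>\<xi>\<bar> \<le> k then of_real (sqrt (k\<^sup>2 - \<xi>\<^sup>2)) else \<i> * of_real (sqrt (\<xi>\<^sup>2 - k\<^sup>2)))"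

definition beat :: "real \<times> complex \<Rightarrow> real \<times> complex \<Rightarrow> real \<times> complex" where
  "beat p q = (fst p - fst q, snd p - cnj (snd q))"

lemma plane_wave_beat: "plane_wave p x * cnj (plane_wave q x) = plane_wave (beat p q) x"
  by (simp add: plane_wave_def beat_def exp_cnj algebra_simps flip: exp_add)

lemma vertical_wavenumber_cases:
  assumes "k > 0"
  obtains (propagating) e where "vertical_wavenumber k \<xi> = of_real e" "e \<ge> 0" "\<xi>\<^sup>2 + e\<^sup>2 = k\<^sup>2"
  | (evanescent) f where "vertical_wavenumber k \<xi> = \<i> * of_real f" "f > 0" "\<xi>\<^sup>2 = k\<^sup>2 + f\<^sup>2"
proof (cases "\<bar>\<xi>\<bar> \<le> k")
  case True
  then have "\<xi>\<^sup>2 \<le> k\<^sup>2" using assms by (simp add: abs_le_square_iff[symmetric])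
  then show ?thesis using True propagating by (simp add: vertical_wavenumber_def)
next
  case False
  then have "\<xi>\<^sup>2 > k\<^sup>2" using assms abs_le_square_iff[of \<xi> k] by auto
  then show ?thesis using False evanescent[of "sqrt (\<xi>\<^sup>2 - k\<^sup>2)"]
    by (simp add: vertical_wavenumber_def)
qed

lemma vertical_wavenumber_nonneg:
  assumes "k > 0"
  shows "Re (vertical_wavenumber k \<xi>) \<ge> 0" and "Im (vertical_wavenumber k \<xi>) \<ge> 0"
  by (cases rule: vertical_wavenumber_cases[OF assms, of \<xi>]; simp)+

text \<open>The point \<open>(\<xi>', c + e + \<beta>)\<close> of the circle differs from the scattered wave vector \<open>(\<xi>'', c)\<close> as
  \<open>(\<xi>, e)\<close> differs from the incident wave vector \<open>(\<alpha>, -\<beta>)\<close>. The chords from \<open>(\<alpha>, -\<beta>)\<close> to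
  \<open>(\<xi>'', c)\<close> and to \<open>(\<xi>, e)\<close> then enclose a right angle, so by Thales \<open>(\<xi>'', c)\<close> and \<open>(\<xi>, e)\<close> are
  antipodal. In the proof \<open>(-A, C)\<close> and \<open>(-B, D)\<close> are these two chords, and \<open>(X, Y)\<close> is the sum
  of the two antipodal points, which has to vanish.\<close>

lemma equal_chords_antipodal:
  fixes \<alpha> \<beta> \<xi> e \<xi>' \<xi>'' c k :: real
  assumes "\<alpha>\<^sup>2 + \<beta>\<^sup>2 = k\<^sup>2" and "\<xi>\<^sup>2 + e\<^sup>2 = k\<^sup>2" and "\<xi>''\<^sup>2 + c\<^sup>2 = k\<^sup>2"
    and "\<xi>'\<^sup>2 + (c + e + \<beta>)\<^sup>2 = k\<^sup>2" and "\<xi>' = \<xi>'' + \<xi> - \<alpha>"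
    and pos: "\<beta> > 0" "c \<ge> 0" "e \<ge> 0"
  shows "\<xi>' = - \<alpha>"
proof -
  define A B C D where "A = \<alpha> - \<xi>''" and "B = \<alpha> - \<xi>" and "C = \<beta> + c" and "D = \<beta> + e"
  define X Y where "X = 2 * \<alpha> - A - B" and "Y = C + D - 2 * \<beta>"
  have "A * B = - (C * D)" and "A * (X + B) = C * (Y - D)"
    using assms(1-5) unfolding A_def B_def C_def D_def X_def Y_def by algebra+
  then have "A * X = C * Y" by algebra
  moreover have "B * (X + A) = D * (Y - C)"
    using assms(1-3) unfolding A_def B_def C_def D_def X_def Y_def by algebra
  then have "B * X = D * Y" using \<open>A * B = - (C * D)\<close> by algebra
  ultimately have "D * (A * Y + C * X) = 0" using \<open>A * B = - (C * D)\<close> by algebra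
  then have "A * Y = - (C * X)" using pos by (simp add: D_def)
  then have "(A\<^sup>2 + C\<^sup>2) * X = 0" using \<open>A * X = C * Y\<close> by algebra
  moreover have "A\<^sup>2 + C\<^sup>2 > 0" using pos by (simp add: C_def add_nonneg_pos)
  ultimately have "X = 0" by (metis less_irrefl mult_eq_0_iff)
  then show ?thesis using assms(5) by (simp add: X_def A_def B_def)
qed

text \<open>If two scattered modes beat in the same way as a scattered mode with the incident wave, then
  the first of them has the horizontal wave number of the point antipodal to \<open>(\<alpha>, -\<beta>)\<close>. The real
  part of the vertical equation compares oscillations and forces the first mode to propagate,
  the imaginary part compares decay rates and makes the other two both propagating or both
  evanescent.\<close>

lemma scattered_beat_imp_mirror:
  assumes "k > 0" "\<beta> > 0" and circle: "\<alpha>\<^sup>2 + \<beta>\<^sup>2 = k\<^sup>2"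
    and horizontal: "\<xi>' - \<xi>'' = \<xi> - \<alpha>"
    and vertical: "vertical_wavenumber k \<xi>' - cnj (vertical_wavenumber k \<xi>'')
           = vertical_wavenumber k \<xi> + of_real \<beta>"
  shows "\<xi>' = - \<alpha>"
proof (cases rule: vertical_wavenumber_cases[OF \<open>k > 0\<close>, of \<xi>', case_names propagating' evanescent'])
  case (evanescent' f)
  then have "Re (vertical_wavenumber k \<xi>' - cnj (vertical_wavenumber k \<xi>'')) \<le> 0"
    by (cases rule: vertical_wavenumber_cases[OF \<open>k > 0\<close>, of \<xi>'', case_names propagating'' evanescent'']) auto
  moreover have "Re (vertical_wavenumber k \<xi> + of_real \<beta>) > 0"
    using \<open>\<beta> > 0\<close> by (cases rule: vertical_wavenumber_cases[OF \<open>k > 0\<close>, of \<xi>]) auto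
  ultimately show ?thesis using vertical by simp
next
  case (propagating' a)
  show ?thesis
  proof (cases rule: vertical_wavenumber_cases[OF \<open>k > 0\<close>, of \<xi>'', case_names propagating'' evanescent''])
    case (propagating'' c)
    show ?thesis
    proof (cases rule: vertical_wavenumber_cases[OF \<open>k > 0\<close>, of \<xi>, case_names propagating evanescent])
      case (propagating e)
      have "a = c + e + \<beta>"
        using vertical propagating' propagating'' propagating by (simp add: complex_eq_iff)
      moreover have "\<xi>' = \<xi>'' + \<xi> - \<alpha>" using horizontal by simp
      ultimately show ?thesis
        using equal_chords_antipodal[OF circle propagating(3) propagating''(3), of \<xi>']
          propagating'(3) propagating''(2) propagating(2) \<open>\<beta> > 0\<close> by blast
    next
      case (evanescent f)
      then show ?thesis using vertical propagating' propagating'' by (simp add: complex_eq_iff)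
    qed
  next
    case (evanescent'' d)
    show ?thesis
    proof (cases rule: vertical_wavenumber_cases[OF \<open>k > 0\<close>, of \<xi>, case_names propagating evanescent])
      case (propagating e)
      then show ?thesis using vertical propagating' evanescent'' by (simp add: complex_eq_iff)
    next
      case (evanescent f)
      then have "a = \<beta>" "d = f"
        using vertical propagating' evanescent'' by (auto simp: complex_eq_iff)
      then have "\<xi>'\<^sup>2 = \<alpha>\<^sup>2" "\<xi>''\<^sup>2 = \<xi>\<^sup>2"
        using circle propagating' evanescent'' evanescent by auto
      \<comment> \<open>Of the four sign choices, \<open>\<xi>' = \<alpha>\<close> with \<open>\<xi>'' = \<xi>\<close> would make \<open>\<xi> = \<alpha>\<close> propagating, and
        \<open>\<xi>' = \<alpha>\<close> with \<open>\<xi>'' = - \<xi>\<close> is only possible for \<open>\<alpha> = 0\<close>. In that case \<open>\<alpha> = - \<alpha>\<close>.\<close>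
      moreover have "\<xi>\<^sup>2 > \<alpha>\<^sup>2"
        using evanescent circle by (smt (verit) zero_less_power zero_le_power2)
      ultimately show ?thesis
        using horizontal by (auto simp: power2_eq_iff)
    qed
  qed
qed

definition incident_vector :: "real \<Rightarrow> real \<Rightarrow> real \<times> complex" where
  "incident_vector k \<theta> = (k * sin \<theta>, - of_real (k * cos \<theta>))"

text \<open>The mirror mode with horizontal wave number \<open>- k sin \<theta>\<close> is left out, since the
  interference of two scattered modes can have the same frequency as that of a scattered mode with
  the incident wave if one of the two is the mirror mode.\<close>

definition grating_modes :: "real \<Rightarrow> real \<Rightarrow> (real \<times> complex) set" where
  "grating_modes k \<theta> = insert (incident_vector k \<theta>)
     {(\<xi>, vertical_wavenumber k \<xi>) | \<xi>. \<xi> \<noteq> - k * sin \<theta>}"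

lemma grating_modes_Im_nonneg:
  assumes "k > 0" and "p \<in> grating_modes k \<theta>"
  shows "Im (snd p) \<ge> 0"
  using assms vertical_wavenumber_nonneg[OF \<open>k > 0\<close>]
  by (auto simp: grating_modes_def incident_vector_def)

text \<open>A pair \<open>(p, q)\<close> with \<open>p\<close> incident and \<open>q\<close> scattered has the wrong sign of oscillation in \<open>x\<^sub>2\<close>;
  a pair of two scattered modes would contain the horizontal wave number \<open>- k sin \<theta>\<close>.\<close>

lemma incident_beat_unique:
  assumes "k > 0" "cos \<theta> > 0"
    and p: "p \<in> grating_modes k \<theta>" and q: "q \<in> grating_modes k \<theta>"
    and s: "s \<in> grating_modes k \<theta>" "s \<noteq> incident_vector k \<theta>"
    and eq: "beat p q = beat s (incident_vector k \<theta>)"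
  shows "p = s \<and> q = incident_vector k \<theta>"
proof (cases "q = incident_vector k \<theta>")
  case True
  then show ?thesis using eq by (auto simp: beat_def prod_eq_iff)
next
  case False
  then obtain \<xi>'' where q: "q = (\<xi>'', vertical_wavenumber k \<xi>'')"
    using q by (auto simp: grating_modes_def)
  obtain \<xi> where s: "s = (\<xi>, vertical_wavenumber k \<xi>)"
    using s by (auto simp: grating_modes_def)
  define \<beta> where "\<beta> = k * cos \<theta>"
  have "\<beta> > 0" using assms(1,2) by (simp add: \<beta>_def)
  have horizontal: "fst p - \<xi>'' = \<xi> - k * sin \<theta>"
    and vertical: "snd p - cnj (vertical_wavenumber k \<xi>'') = vertical_wavenumber k \<xi> + of_real \<beta>"
    using eq by (auto simp: beat_def q s incident_vector_def \<beta>_def)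
  have "p \<noteq> incident_vector k \<theta>"
  proof
    assume "p = incident_vector k \<theta>"
    then have "snd p = - of_real \<beta>" by (simp add: incident_vector_def \<beta>_def)
    then show False
      using arg_cong[OF vertical, of Re] vertical_wavenumber_nonneg(1)[OF \<open>k > 0\<close>, of \<xi>]
        vertical_wavenumber_nonneg(1)[OF \<open>k > 0\<close>, of \<xi>''] \<open>\<beta> > 0\<close> by simp
  qed
  then obtain \<xi>' where p: "p = (\<xi>', vertical_wavenumber k \<xi>')" "\<xi>' \<noteq> - k * sin \<theta>"
    using p by (auto simp: grating_modes_def)
  have "(k * sin \<theta>)\<^sup>2 + \<beta>\<^sup>2 = k\<^sup>2"
    by (simp add: \<beta>_def power_mult_distrib flip: distrib_left)
  then have "\<xi>' = - (k * sin \<theta>)"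
    using scattered_beat_imp_mirror[OF \<open>k > 0\<close> \<open>\<beta> > 0\<close>] horizontal vertical by (simp add: p)
  then show ?thesis using p by simp
qed

section \<open>Expansions of total fields\<close>

text \<open>The amplitudes are extended by zero so that two expansions can be compared even if their
  sets of modes differ. The finiteness condition bounds the number of modes that
  decay no faster than a given rate, as the removal of terms needs.\<close>

definition mode_expansion ::
  "real \<Rightarrow> real \<Rightarrow> real \<Rightarrow> (real^2 \<Rightarrow> complex) \<Rightarrow> (real \<times> complex) set \<Rightarrow>
     (real \<times> complex \<Rightarrow> complex) \<Rightarrow> bool" where
  "mode_expansion k \<theta> h u P a \<longleftrightarrow>
     P \<subseteq> grating_modes k \<theta> \<and> incident_vector k \<theta> \<in> P \<and> a (incident_vector k \<theta>) = 1 \<and>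
     (\<forall>p. p \<notin> P \<longrightarrow> a p = 0) \<and> (\<forall>B. finite {p \<in> P. Im (snd p) \<le> B}) \<and>
     (\<forall>x\<in>upper_half_plane h. ((\<lambda>p. a p * plane_wave p x) has_sum u x) P)"

lemma mode_expansion_squared_modulus:
  assumes "mode_expansion k \<theta> h u P a" and x: "x \<in> upper_half_plane h"
  shows "((\<lambda>j. a (fst j) * cnj (a (snd j)) * plane_wave (beat (fst j) (snd j)) x)
           has_sum of_real ((cmod (u x))\<^sup>2)) (P \<times> P)"
proof -
  define f where "f p = a p * plane_wave p x" for p
  have f: "(f has_sum u x) P"
    using assms unfolding mode_expansion_def f_def by blast
  then have abs: "(\<lambda>p. norm (f p)) summable_on P"
    using has_sum_imp_summable summable_on_iff_abs_summable_on_complex by blast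
  have "(\<lambda>j. norm (f (fst j) * cnj (f (snd j)))) summable_on P \<times> P"
    unfolding Infinite_Sum.abs_summable_on_Sigma_iff
    using abs by (auto simp: norm_mult abs_mult infsum_cmult_right' intro!: summable_on_cmult_right
        summable_on_cmult_left)
  then have "(\<lambda>j. f (fst j) * cnj (f (snd j))) summable_on P \<times> P"
    using summable_on_iff_abs_summable_on_complex by blast
  then have "((\<lambda>j. f (fst j) * cnj (f (snd j))) has_sum (u x * cnj (u x))) (P \<times> P)"
    using f by (intro has_sum_SigmaI[where g = "\<lambda>p. f p * cnj (u x)"])
      (auto intro!: has_sum_cmult_right has_sum_cmult_left)
  moreover have "f p * cnj (f q) = a p * cnj (a q) * plane_wave (beat p q) x" for p q
    by (simp add: f_def flip: plane_wave_beat)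
  ultimately show ?thesis by (simp only: complex_norm_square)
qed

text \<open>The interference of \<open>p\<close> with the incident wave has coefficient \<open>a1 p\<close> in one squared modulus
  and \<open>a2 p\<close> in the other, and no other term of either has its frequency.\<close>

lemma equal_modulus_imp_equal_amplitudes:
  assumes "k > 0" "cos \<theta> > 0"
    and e1: "mode_expansion k \<theta> h u1 P1 a1" and e2: "mode_expansion k \<theta> h u2 P2 a2"
    and modulus: "\<forall>x\<in>upper_half_plane h. cmod (u1 x) = cmod (u2 x)"
  shows "a1 p = a2 p"
proof -
  define i where "i = incident_vector k \<theta>"
  have P: "P1 \<subseteq> grating_modes k \<theta>" "P2 \<subseteq> grating_modes k \<theta>" "i \<in> P1" "i \<in> P2"
    and a: "a1 i = 1" "a2 i = 1" "\<And>p. a1 p \<noteq> 0 \<Longrightarrow> p \<in> P1" "\<And>p. a2 p \<noteq> 0 \<Longrightarrow> p \<in> P2"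
    and fin: "\<And>B. finite {p \<in> P1. Im (snd p) \<le> B}" "\<And>B. finite {p \<in> P2. Im (snd p) \<le> B}"
    using e1 e2 unfolding mode_expansion_def i_def by blast+
  define J where "J = (P1 \<union> P2) \<times> (P1 \<union> P2)"
  define w where "w j = beat (fst j) (snd j)" for j
  define c where "c j = a1 (fst j) * cnj (a1 (snd j)) - a2 (fst j) * cnj (a2 (snd j))" for j
  show ?thesis
  proof (cases "p \<in> (P1 \<union> P2) - {i}")
    case True
    have "c (p, i) = 0"
    proof (rule isolated_coefficient_eq_0[where w = w and J = J and h = h])
      fix B
      have "Im (snd p) \<ge> 0" if "p \<in> P1 \<union> P2" for p
        using that P(1,2) grating_modes_Im_nonneg[OF \<open>k > 0\<close>] by blast
      then have "{j \<in> J. Im (snd (w j)) \<le> B}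
          \<subseteq> {p \<in> P1 \<union> P2. Im (snd p) \<le> B} \<times> {p \<in> P1 \<union> P2. Im (snd p) \<le> B}"
        by (fastforce simp: J_def w_def beat_def)
      moreover have "finite {p \<in> P1 \<union> P2. Im (snd p) \<le> B}"
        using fin[of B] by (auto simp: conj_disj_distribR)
      ultimately show "finite {j \<in> J. Im (snd (w j)) \<le> B}"
        by (blast intro: finite_subset finite_SigmaI)
    next
      show "\<forall>x\<in>upper_half_plane h. ((\<lambda>j. c j * plane_wave (w j) x) has_sum 0) J"
      proof
        fix x assume x: "x \<in> upper_half_plane h"
        have sum1: "((\<lambda>j. a1 (fst j) * cnj (a1 (snd j)) * plane_wave (w j) x)
            has_sum of_real ((cmod (u1 x))\<^sup>2)) J"
          using mode_expansion_squared_modulus[OF e1 x]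
          by (rule has_sum_cong_neutral[THEN iffD1, rotated 3])
            (auto simp: J_def w_def intro: a(3,4))
        have sum2: "((\<lambda>j. a2 (fst j) * cnj (a2 (snd j)) * plane_wave (w j) x)
            has_sum of_real ((cmod (u2 x))\<^sup>2)) J"
          using mode_expansion_squared_modulus[OF e2 x]
          by (rule has_sum_cong_neutral[THEN iffD1, rotated 3])
            (auto simp: J_def w_def intro: a(3,4))
        have "((\<lambda>j. - (a2 (fst j) * cnj (a2 (snd j)) * plane_wave (w j) x))
            has_sum - of_real ((cmod (u2 x))\<^sup>2)) J"
          using sum2 by (simp add: has_sum_uminus)
        from has_sum_add[OF sum1 this]
        show "((\<lambda>j. c j * plane_wave (w j) x) has_sum 0) J"
          using modulus x by (simp add: c_def algebra_simps)
      qed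
    next
      show "(p, i) \<in> J" using True P by (auto simp: J_def)
    next
      have p: "p \<in> grating_modes k \<theta>" "p \<noteq> i" using True P by auto
      have "p' = p \<and> q' = i" if "(p', q') \<in> J" "beat p' q' = beat p i" for p' q'
      proof -
        have "p' \<in> grating_modes k \<theta>" "q' \<in> grating_modes k \<theta>"
          using that(1) P(1,2) by (auto simp: J_def)
        then show ?thesis
          using incident_beat_unique[OF assms(1,2)] p that(2) unfolding i_def by blast
      qed
      then show "\<forall>j\<in>J - {(p, i)}. w j \<noteq> w (p, i)"
        by (auto simp: w_def)
    qed
    then show ?thesis using a(1,2) by (simp add: c_def)
  next
    case False
    then show ?thesis using a by (metis DiffI UnI1 UnI2 singletonD)
  qed
qed

lemma mode_expansion_equal_amplitudes:
  assumes "mode_expansion k \<theta> h u1 P1 a" and "mode_expansion k \<theta> h u2 P2 a"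
    and x: "x \<in> upper_half_plane h"
  shows "u1 x = u2 x"
proof (rule has_sum_unique)
  show "((\<lambda>p. a p * plane_wave p x) has_sum u1 x) P1"
    using assms by (auto simp: mode_expansion_def)
  have "((\<lambda>p. a p * plane_wave p x) has_sum u2 x) P2"
    using assms by (auto simp: mode_expansion_def)
  then show "((\<lambda>p. a p * plane_wave p x) has_sum u2 x) P1"
    by (rule has_sum_cong_neutral[THEN iffD1, rotated 3])
      (use assms in \<open>auto simp: mode_expansion_def\<close>)
qed

lemma incident_field_plane_wave: "incident_field k \<theta> x = plane_wave (incident_vector k \<theta>) x"
  by (simp add: incident_field_def plane_wave_def incident_vector_def mult_ac)

lemma finite_low_rate_modes:
  assumes "L > 0" "k > 0"
  shows "finite {n. Im (beta_n L k \<theta> n) \<le> B}"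
proof -
  define M where "M = k + \<bar>B\<bar>"
  have "\<bar>alpha_n L k \<theta> n\<bar> \<le> M" if n: "Im (beta_n L k \<theta> n) \<le> B" for n
  proof (cases "\<bar>alpha_n L k \<theta> n\<bar> \<le> k")
    case False
    define \<xi> where "\<xi> = \<bar>alpha_n L k \<theta> n\<bar>"
    have "sqrt (\<xi>\<^sup>2 - k\<^sup>2) \<le> \<bar>B\<bar>"
      using n False by (simp add: beta_n_def \<xi>_def)
    then have "\<xi>\<^sup>2 - k\<^sup>2 \<le> B\<^sup>2" using real_sqrt_le_iff[of _ "B\<^sup>2"] by simp
    also have "B\<^sup>2 \<le> M\<^sup>2 - k\<^sup>2"
      using \<open>k > 0\<close> by (simp add: M_def power2_sum)
    finally show ?thesis
      using \<open>k > 0\<close> by (simp add: \<xi>_def M_def flip: abs_le_square_iff)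
  qed (simp add: M_def)
  moreover have "\<bar>of_int n\<bar> \<le> (M + k) * L / (2 * pi)" if "\<bar>alpha_n L k \<theta> n\<bar> \<le> M" for n
  proof -
    have "\<bar>k * sin \<theta>\<bar> \<le> k * 1"
      using \<open>k > 0\<close> unfolding abs_mult by (intro mult_mono) auto
    then have "\<bar>2 * of_int n * pi / L\<bar> \<le> M + k"
      using that unfolding alpha_n_def by linarith
    then show ?thesis
      using \<open>L > 0\<close> by (simp add: abs_mult field_simps)
  qed
  ultimately have bound: "\<bar>of_int n\<bar> \<le> (M + k) * L / (2 * pi)"
    if "Im (beta_n L k \<theta> n) \<le> B" for n
    using that by blast
  have "{n. Im (beta_n L k \<theta> n) \<le> B}
      \<subseteq> {- \<lceil>(M + k) * L / (2 * pi)\<rceil> .. \<lceil>(M + k) * L / (2 * pi)\<rceil>}"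
  proof
    fix n assume "n \<in> {n. Im (beta_n L k \<theta> n) \<le> B}"
    then have "\<bar>of_int n\<bar> \<le> (M + k) * L / (2 * pi)" using bound by blast
    then have "\<bar>n\<bar> \<le> \<lceil>(M + k) * L / (2 * pi)\<rceil>" by linarith
    then show "n \<in> {- \<lceil>(M + k) * L / (2 * pi)\<rceil> .. \<lceil>(M + k) * L / (2 * pi)\<rceil>}" by auto
  qed
  then show ?thesis by (rule finite_subset) simp
qed

text \<open>This rests on the hypothesis on \<open>k L sin \<theta> / \<pi>\<close>, which says that no \<open>alpha_n\<close> equals \<open>- k sin \<theta>\<close>.\<close>

lemma total_field_mode_expansion:
  assumes "L > 0" "k > 0" "cos \<theta> > 0" and nonresonant: "k * L * sin \<theta> / pi \<notin> \<int>"
    and rayleigh: "rayleigh_expansion L k \<theta> \<Gamma> (\<lambda>x. u x - incident_field k \<theta> x)"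
    and h: "h > max_height \<Gamma>"
  shows "\<exists>P a. mode_expansion k \<theta> h u P a"
proof -
  obtain A where A: "\<And>x. x \<in> upper_half_plane h \<Longrightarrow>
      ((\<lambda>n. A n * exp (\<i> * of_real (alpha_n L k \<theta> n) * of_real (x $ 1)
                          + \<i> * beta_n L k \<theta> n * of_real (x $ 2)))
           has_sum u x - incident_field k \<theta> x) UNIV"
    using rayleigh h unfolding rayleigh_expansion_def by blast
  define i where "i = incident_vector k \<theta>"
  define m where "m n = (alpha_n L k \<theta> n, beta_n L k \<theta> n)" for n
  define P where "P = insert i (range m)"
  define a where "a p = (if p = i then 1 else if p \<in> range m then A (inv m p) else 0)" for p
  have "inj m"
    using \<open>L > 0\<close> by (auto simp: inj_on_def m_def alpha_n_def)
  have mirror: "alpha_n L k \<theta> n \<noteq> - k * sin \<theta>" for n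
  proof
    assume "alpha_n L k \<theta> n = - k * sin \<theta>"
    then have "k * L * sin \<theta> / pi = of_int (- n)"
      using \<open>L > 0\<close> by (simp add: alpha_n_def field_simps)
    then show False using nonresonant Ints_of_int by metis
  qed
  have m_mode: "m n = (alpha_n L k \<theta> n, vertical_wavenumber k (alpha_n L k \<theta> n))" for n
    by (simp add: m_def beta_n_def vertical_wavenumber_def)
  have "Re (snd (m n)) \<ge> 0" for n
    using \<open>k > 0\<close> by (simp add: m_def beta_n_def flip: abs_le_square_iff)
  moreover have "Re (snd i) < 0"
    using assms(2,3) by (simp add: i_def incident_vector_def)
  ultimately have "i \<notin> range m"
    by (metis imageE linorder_not_less)
  have "finite {p \<in> P. Im (snd p) \<le> B}" for B
  proof (rule finite_subset)
    show "{p \<in> P. Im (snd p) \<le> B} \<subseteq> insert i (m ` {n. Im (beta_n L k \<theta> n) \<le> B})"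
      by (auto simp: P_def m_def)
  qed (use finite_low_rate_modes[OF assms(1,2)] in simp)
  moreover have "((\<lambda>p. a p * plane_wave p x) has_sum u x) P" if x: "x \<in> upper_half_plane h" for x
  proof -
    have "a (m n) * plane_wave (m n) x = A n * exp (\<i> * of_real (alpha_n L k \<theta> n) * of_real (x $ 1)
        + \<i> * beta_n L k \<theta> n * of_real (x $ 2))" for n
    proof -
      have "m n \<noteq> i" using \<open>i \<notin> range m\<close> by blast
      then have "a (m n) = A n" using \<open>inj m\<close> by (simp add: a_def)
      then show ?thesis by (simp add: plane_wave_def m_def)
    qed
    then have "((\<lambda>n. a (m n) * plane_wave (m n) x) has_sum (u x - incident_field k \<theta> x)) UNIV"
      using A[OF x] by simp
    then have "((\<lambda>p. a p * plane_wave p x) has_sum (u x - incident_field k \<theta> x)) (range m)"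
      by (simp add: has_sum_reindex[OF \<open>inj m\<close>] o_def)
    from has_sum_insert[OF \<open>i \<notin> range m\<close> this]
    show ?thesis by (simp add: P_def a_def i_def incident_field_plane_wave)
  qed
  moreover have "P \<subseteq> grating_modes k \<theta>"
    using mirror unfolding P_def grating_modes_def i_def by (auto simp: m_mode)
  ultimately have "mode_expansion k \<theta> h u P a"
    unfolding mode_expansion_def by (auto simp: P_def a_def i_def)
  then show ?thesis by blast
qed

lemma max_height_mono:
  assumes "\<Gamma> \<subseteq> \<Gamma>'" "\<Gamma> \<noteq> {}" "bounded ((\<lambda>x. x $ 2) ` \<Gamma>')"
  shows "max_height \<Gamma> \<le> max_height \<Gamma>'"
  unfolding max_height_def
  using assms by (intro cSUP_subset_mono) (auto intro: bounded_imp_bdd_above)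

theorem theorem5p2:
  fixes k L1 L2 \<theta> h :: real
    and \<Gamma>1 \<Gamma>2 :: "(real^2) set"
    and u1 u2 :: "real^2 \<Rightarrow> complex"
  assumes "k > 0" and "L1 > 0" and "L2 > 0"
    and "periodic_curve L1 \<Gamma>1" and "periodic_curve L2 \<Gamma>2"
    and "(C3_graph \<Gamma>1 \<and> C3_graph \<Gamma>2) \<or> (analytic_curve \<Gamma>1 \<and> analytic_curve \<Gamma>2)"
    and "\<theta> \<in> {- pi / 2 <..< pi / 2}"
    and "k * L1 * sin \<theta> / pi \<notin> \<int>" and "k * L2 * sin \<theta> / pi \<notin> \<int>"
    and "diffraction_solution L1 k \<theta> \<Gamma>1 u1"
    and "diffraction_solution L2 k \<theta> \<Gamma>2 u2"
    and "h > max_height (\<Gamma>1 \<union> \<Gamma>2)"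
    and "\<forall>x\<in>upper_half_plane h. cmod (u1 x) = cmod (u2 x)"
  shows "\<forall>x\<in>upper_half_plane h. u1 x = u2 x"
proof -
  have "cos \<theta> > 0" using assms(7) by (intro cos_gt_zero_pi) auto
  have "\<Gamma>1 \<noteq> {}" "\<Gamma>2 \<noteq> {}"
    using assms(4,5) homeomorphic_empty unfolding periodic_curve_def by blast+
  moreover have "bounded ((\<lambda>x. x $ 2) ` (\<Gamma>1 \<union> \<Gamma>2))"
    using assms(4,5) by (simp add: periodic_curve_def image_Un)
  ultimately have h: "h > max_height \<Gamma>1" "h > max_height \<Gamma>2"
    using max_height_mono[of \<Gamma>1 "\<Gamma>1 \<union> \<Gamma>2"] max_height_mono[of \<Gamma>2 "\<Gamma>1 \<union> \<Gamma>2"] assms(12)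
    by auto
  obtain P1 a1 where e1: "mode_expansion k \<theta> h u1 P1 a1"
    using total_field_mode_expansion[OF assms(2,1) \<open>cos \<theta> > 0\<close> assms(8) _ h(1)] assms(10)
    unfolding diffraction_solution_def by blast
  obtain P2 a2 where e2: "mode_expansion k \<theta> h u2 P2 a2"
    using total_field_mode_expansion[OF assms(3,1) \<open>cos \<theta> > 0\<close> assms(9) _ h(2)] assms(11)
    unfolding diffraction_solution_def by blast
  have "a1 = a2"
    using equal_modulus_imp_equal_amplitudes[OF assms(1) \<open>cos \<theta> > 0\<close> e1 e2 assms(13)] by blast
  then show ?thesis
    using mode_expansion_equal_amplitudes e1 e2 by blast
qed

end
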